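(* For any $p\in[1,\infty]$, the spectral radius $\rho(L_{T,p})$ of the forward Collatz-Koopman operator $L_{T,p}\colon\ell_p\to\ell_p$ satisfies $$1\le\rho(L_{T,p})\le\varphi^{1-\frac1p},$$ where $\varphi=\frac{1+\sqrt5}{2}$. In particular $\rho(L_{T,1})=1$.
   Context: $\mathbb{N}^*=\{1,2,3,\dots\}$. The Collatz map $T\colon\mathbb{N}^*\to\mathbb{N}^*$ is $T(n)=n/2$ for $n$ even and $T(n)=(3n+1)/2$ for $n$ odd. $\ell_p$ is the usual Banach space of scalar sequences indexed by $\mathbb{N}^*$. The bounded operator $L_{T,p}$ sends $x=(x_n)$ to the sequence with $m$-th coordinate $\sum_{n:\,T(n)=m}x_n$ (so $L_{T,p}(e_n)=e_{T(n)}$). The spectral radius of a bounded operator $A$ is $\rho(A)=\lim_{n\to\infty}\|A^n\|^{1/n}$. Convention: $1/\infty=0$. *)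

theory Defs
  imports "HOL-Analysis.Analysis"
begin

text \<open>The sequence space \<open>\<ell>\<^sub>p\<close>, \<open>1 \<le> p \<le> \<infinity>\<close>, over the index set \<open>{1, 2, 3, \<dots>}\<close>.
  A sequence is a function on \<^typ>\<open>nat\<close> whose value at the unused index \<open>0\<close> is \<open>0\<close>, so that
  a sequence is determined by its coordinates.  The scalars are any complete real normed field,
  which covers both \<^typ>\<open>real\<close> and \<^typ>\<open>complex\<close>.\<close>

definition lp_space :: "ennreal \<Rightarrow> (nat \<Rightarrow> 'a::{real_normed_field,banach}) set" where
  "lp_space p = {x. x 0 = 0 \<and>
     (if p = \<infinity> then bdd_above ((\<lambda>n. norm (x n)) ` {1..})
      else (\<lambda>n. norm (x n) powr enn2real p) summable_on {1..})}"

definition lp_norm :: "ennreal \<Rightarrow> (nat \<Rightarrow> 'a::{real_normed_field,banach}) \<Rightarrow> real" where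
  "lp_norm p x =
     (if p = \<infinity> then (SUP n\<in>{1..}. norm (x n))
      else (\<Sum>\<^sub>\<infinity>n\<in>{1..}. norm (x n) powr enn2real p) powr (1 / enn2real p))"

text \<open>Operator norm of a bounded operator on \<open>\<ell>\<^sub>p\<close>: the library's \<^const>\<open>onorm\<close>, relativised to
  the carrier set (as there, the zero vector contributes \<open>0 / 0 = 0\<close>).\<close>

definition lp_onorm ::
  "ennreal \<Rightarrow> ((nat \<Rightarrow> 'a::{real_normed_field,banach}) \<Rightarrow> (nat \<Rightarrow> 'a)) \<Rightarrow> real" where
  "lp_onorm p A = (SUP x\<in>lp_space p. lp_norm p (A x) / lp_norm p x)"

definition lp_spectral_radius ::
  "ennreal \<Rightarrow> ((nat \<Rightarrow> 'a::{real_normed_field,banach}) \<Rightarrow> (nat \<Rightarrow> 'a)) \<Rightarrow> real" where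
  "lp_spectral_radius p A = lim (\<lambda>n. root n (lp_onorm p (A ^^ n)))"

definition collatz :: "nat \<Rightarrow> nat" where
  "collatz n = (if even n then n div 2 else (3 * n + 1) div 2)"

text \<open>The formula does not depend on \<open>p\<close>; the exponent enters through the space on which the
  operator acts.  The sum is finite, see \<open>collatz_fibre\<close> below.\<close>

definition forward_koopman ::
  "(nat \<Rightarrow> 'a::{real_normed_field,banach}) \<Rightarrow> (nat \<Rightarrow> 'a)" where
  "forward_koopman x = (\<lambda>m. \<Sum>n | 1 \<le> n \<and> collatz n = m. x n)"

lemma collatz_fibre:
  "finite {n. 1 \<le> n \<and> collatz n = m}" "card {n. 1 \<le> n \<and> collatz n = m} \<le> 2"
proof -
  have sub: "{n. 1 \<le> n \<and> collatz n = m} \<subseteq> {2 * m, (2 * m - 1) div 3}"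
  proof
    fix n assume "n \<in> {n. 1 \<le> n \<and> collatz n = m}"
    then have "collatz n = m" by simp
    then show "n \<in> {2 * m, (2 * m - 1) div 3}"
      by (cases "even n") (auto simp: collatz_def elim!: evenE oddE)
  qed
  show "finite {n. 1 \<le> n \<and> collatz n = m}"
    using finite_subset[OF sub] by simp
  have "card {n. 1 \<le> n \<and> collatz n = m} \<le> card {2 * m, (2 * m - 1) div 3}"
    using sub by (intro card_mono) auto
  also have "\<dots> \<le> 2"
    using card_insert_le_m1[of 2 "{(2 * m - 1) div 3}" "2 * m"] by simp
  finally show "card {n. 1 \<le> n \<and> collatz n = m} \<le> 2" .
qed

lemma collatz_ge_1: "1 \<le> n \<Longrightarrow> 1 \<le> collatz n"
  by (cases "even n") (auto simp: collatz_def elim!: evenE oddE)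

lemma forward_koopman_0: "forward_koopman x 0 = 0"
proof -
  have empty: "{n. 1 \<le> n \<and> collatz n = 0} = {}"
    using collatz_ge_1 by fastforce
  show ?thesis
    unfolding forward_koopman_def empty by simp
qed

lemma forward_koopman_unit_vector:
  assumes "1 \<le> n"
  shows "forward_koopman (\<lambda>k. if k = n then 1 else 0) = (\<lambda>k. if k = collatz n then 1 else 0)"
  using assms collatz_fibre(1) by (auto simp: forward_koopman_def fun_eq_iff sum.delta')

text \<open>The operator is a bounded operator on \<open>\<ell>\<^sub>p\<close>, so that the quantities above are not
  the default values of \<^const>\<open>Sup\<close> and \<^const>\<open>infsum\<close>.\<close>

lemma forward_koopman_bounded:
  fixes x :: "nat \<Rightarrow> 'a::{real_normed_field,banach}"
  assumes p: "1 \<le> p" and x: "x \<in> lp_space p"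
  shows "forward_koopman x \<in> lp_space p \<and> lp_norm p (forward_koopman x) \<le> 2 * lp_norm p x"
proof (cases "p = \<infinity>")
  case True
  have bdd: "bdd_above ((\<lambda>n. norm (x n)) ` {1..})"
    using x True by (simp add: lp_space_def)
  define M where "M = (SUP n\<in>{1..}. norm (x n))"
  have M: "norm (x n) \<le> M" if "1 \<le> n" for n
    unfolding M_def using that bdd by (intro cSUP_upper) auto
  have M0: "0 \<le> M"
    using M[of 1] norm_ge_zero[of "x 1"] by linarith
  have le: "norm (forward_koopman x m) \<le> 2 * M" for m
  proof -
    have "norm (forward_koopman x m) \<le> real (card {n. 1 \<le> n \<and> collatz n = m}) * M"
      unfolding forward_koopman_def using M by (intro sum_norm_bound) auto
    also have "\<dots> \<le> 2 * M"
      using collatz_fibre(2)[of m] M0 by (intro mult_right_mono) auto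
    finally show ?thesis .
  qed
  show ?thesis
    using True le by (auto simp: lp_space_def lp_norm_def forward_koopman_0 M_def
        intro!: bdd_aboveI2[where M = "2 * M"] cSUP_least)
next
  case False
  define q where "q = enn2real p"
  have q: "1 \<le> q"
    using enn2real_mono[OF p] False by (simp add: q_def top.not_eq_extremum)
  define g where "g n = norm (x n) powr q" for n
  define S where "S m = {n. 1 \<le> n \<and> collatz n = m}" for m
  have fk: "forward_koopman x m = (\<Sum>n\<in>S m. x n)" for m
    by (simp add: forward_koopman_def S_def)
  have S: "finite (S m)" "card (S m) \<le> 2" for m
    using collatz_fibre[of m] by (auto simp: S_def)
  have g: "g summable_on {1..}"
    using x False by (simp add: lp_space_def g_def[abs_def] q_def)
  have bij: "bij_betw snd (SIGMA m:{1..}. S m) {1..}"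
  proof (rule bij_betw_byWitness[where f' = "\<lambda>n. (collatz n, n)"])
    show "\<forall>z\<in>SIGMA m:{1..}. S m. (collatz (snd z), snd z) = z"
      by (auto simp: S_def)
    show "\<forall>n\<in>{1..}. snd (collatz n, n) = n"
      by simp
    show "snd ` (SIGMA m:{1..}. S m) \<subseteq> {1..}"
      by (auto simp: S_def)
    show "(\<lambda>n. (collatz n, n)) ` {1..} \<subseteq> (SIGMA m:{1..}. S m)"
    proof (rule image_subsetI)
      fix n :: nat assume "n \<in> {1..}"
      then show "(collatz n, n) \<in> (SIGMA m:{1..}. S m)"
        using collatz_ge_1[of n] by (simp add: S_def)
    qed
  qed
  have gS: "(\<lambda>(m, n). g n) summable_on (SIGMA m:{1..}. S m)"
    using summable_on_reindex_bij_betw[OF bij, of g] g by (simp add: case_prod_beta')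
  have sum1: "(\<lambda>m. \<Sum>n\<in>S m. g n) summable_on {1..}"
    using summable_on_Sigma_banach[OF gS] S by simp
  have sum2: "(\<Sum>\<^sub>\<infinity>m\<in>{1..}. \<Sum>n\<in>S m. g n) = (\<Sum>\<^sub>\<infinity>n\<in>{1..}. g n)"
    using infsum_Sigma'_banach[OF gS] S infsum_reindex_bij_betw[OF bij, of g]
    by (simp add: case_prod_beta')
  have g0: "0 \<le> g n" for n by (simp add: g_def)
  have le: "norm (forward_koopman x m) powr q \<le> 2 powr q * (\<Sum>n\<in>S m. g n)" for m
  proof (cases "S m = {}")
    case True
    then show ?thesis by (simp add: fk)
  next
    case False
    define M where "M = Max ((\<lambda>n. norm (x n)) ` S m)"
    have "M \<in> (\<lambda>n. norm (x n)) ` S m"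
      unfolding M_def using False S(1)[of m] by (intro Max_in) auto
    then obtain k where k: "k \<in> S m" "M = norm (x k)"
      by blast
    have "norm (forward_koopman x m) \<le> real (card (S m)) * M"
      unfolding fk
      using S(1)[of m] by (intro sum_norm_bound) (auto simp: M_def)
    also have "\<dots> \<le> 2 * M"
      using S(2)[of m] k by (intro mult_right_mono) auto
    finally have "norm (forward_koopman x m) powr q \<le> (2 * M) powr q"
      using q by (intro powr_mono2) auto
    also have "\<dots> = 2 powr q * g k"
      using k by (simp add: powr_mult g_def)
    also have "\<dots> \<le> 2 powr q * (\<Sum>n\<in>S m. g n)"
      using k S(1)[of m] g0 by (intro mult_left_mono member_le_sum) auto
    finally show ?thesis .
  qed
  have sumL: "(\<lambda>m. norm (forward_koopman x m) powr q) summable_on {1..}"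
    by (rule summable_on_comparison_test[OF summable_on_cmult_right[OF sum1, of "2 powr q"]])
      (use le in auto)
  have "(\<Sum>\<^sub>\<infinity>m\<in>{1..}. norm (forward_koopman x m) powr q)
      \<le> (\<Sum>\<^sub>\<infinity>m\<in>{1..}. 2 powr q * (\<Sum>n\<in>S m. g n))"
    using le by (intro infsum_mono sumL summable_on_cmult_right[OF sum1]) auto
  also have "\<dots> = 2 powr q * (\<Sum>\<^sub>\<infinity>n\<in>{1..}. g n)"
    by (simp only: infsum_cmult_right' sum2)
  finally have "(\<Sum>\<^sub>\<infinity>m\<in>{1..}. norm (forward_koopman x m) powr q) powr (1 / q)
      \<le> (2 powr q * (\<Sum>\<^sub>\<infinity>n\<in>{1..}. g n)) powr (1 / q)"
    using q by (intro powr_mono2 infsum_nonneg) auto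
  also have "\<dots> = 2 * (\<Sum>\<^sub>\<infinity>n\<in>{1..}. g n) powr (1 / q)"
    using q g0 by (simp add: powr_mult infsum_nonneg powr_powr)
  finally show ?thesis
    using False sumL
    by (simp add: lp_space_def lp_norm_def forward_koopman_0 q_def g_def[abs_def])
qed

end

theory Submission
  imports Defs
begin

text \<open>
  The \<open>j\<close>-th power of the forward Koopman operator sums a sequence over the fibres of the
  \<open>j\<close>-th iterate of the Collatz map.  If every such fibre has at most \<open>N\<close> elements, convexity
  of \<open>t \<mapsto> t\<^sup>p\<close> (for \<open>p = \<infinity>\<close>, the triangle inequality) bounds its norm on \<open>\<ell>\<^sub>p\<close> by \<open>N\<close> to
  the exponent \<open>1 - 1/p\<close> (\<open>fibre_sum_bounded\<close>).  So the upper bound is a matter of counting predecessors.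

  Only numbers congruent to \<open>2\<close> modulo \<open>3\<close> have an odd predecessor, and the even predecessor
  \<open>2 * m\<close> of such an \<open>m\<close> is congruent to \<open>1\<close>, so that it does not branch at the next step.
  Hence the largest number \<open>c j\<close> of \<open>j\<close>-fold predecessors obeys the Fibonacci inequality
  \<open>c (j + 2) \<le> c (j + 1) + c j\<close>, and \<open>c j \<le> \<phi> ^ (j + 1)\<close> with the golden ratio \<open>\<phi>\<close>
  (\<open>card_fibre_collatz_le\<close>).  Taking \<open>j\<close>-th roots removes the surplus factor.

  For the lower bound, each power maps the unit vector at \<open>1\<close> to another unit vector, so its
  norm is at least \<open>1\<close>.  The spectral radius is the value of \<^const>\<open>lim\<close>, about which neither
  bound says anything until the sequence of roots is known to converge; this is Fekete's lemma
  (\<open>fekete_convergent\<close>), applied to the logarithms of the submultiplicative operator norms.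
  For \<open>p = 1\<close> the exponent \<open>1 - 1/p\<close> vanishes and the two bounds coincide.
\<close>

section \<open>Subadditive sequences\<close>

lemma subadditive_mult_le:
  fixes u :: "nat \<Rightarrow> real"
  assumes "\<And>m n. u (m + n) \<le> u m + u n"
  shows "u (j * k + r) \<le> real j * u k + u r"
proof (induction j)
  case (Suc j)
  have "u (Suc j * k + r) \<le> u k + u (j * k + r)"
    using assms[of k "j * k + r"] by (simp add: add.assoc)
  with Suc show ?case
    by (simp add: algebra_simps)
qed simp

text \<open>Fekete's lemma: writing \<open>n = j * k + r\<close> with \<open>r < k\<close>, subadditivity gives
  \<open>u n \<le> j * u k + u r\<close>, so that \<open>u n / n\<close> exceeds \<open>u k / k\<close> by at most \<open>O(1 / n)\<close>; the limit
  is therefore the infimum of these quotients.  Nonnegativity makes that infimum finite.\<close>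

lemma fekete_convergent:
  fixes u :: "nat \<Rightarrow> real"
  assumes sub: "\<And>m n. u (m + n) \<le> u m + u n" and nonneg: "\<And>n. 0 \<le> u n"
  shows "convergent (\<lambda>n. u n / real n)"
proof -
  define L where "L = (INF n\<in>{1..}. u n / real n)"
  have bdd: "bdd_below ((\<lambda>n. u n / real n) ` {1..})"
    using nonneg by (intro bdd_belowI2[where m = 0]) simp
  have lower: "L \<le> u n / real n" if "1 \<le> n" for n
    unfolding L_def using that bdd by (intro cINF_lower) auto
  have "(\<lambda>n. u n / real n) \<longlonglongrightarrow> L"
  proof (rule LIMSEQ_I)
    fix e :: real assume e: "0 < e"
    have "\<exists>k\<in>{1..}. u k / real k < L + e / 2"
      using e bdd cINF_less_iff[of "{1..}" "\<lambda>n. u n / real n" "L + e / 2"]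
      by (auto simp: L_def)
    then obtain k :: nat where k: "1 \<le> k" "u k / real k < L + e / 2"
      by auto
    define M where "M = Max (u ` {..<k})"
    have M: "u r \<le> M" if "r < k" for r
      unfolding M_def using that by (intro Max_ge) auto
    obtain n0 :: nat where n0: "2 * M / e < real n0"
      using reals_Archimedean2 by blast
    show "\<exists>no. \<forall>n\<ge>no. norm (u n / real n - L) < e"
    proof (intro exI[of _ "max 1 n0"] allI impI)
      fix n assume n: "max 1 n0 \<le> n"
      then have npos: "0 < real n" by simp
      have "u n \<le> real (n div k) * u k + u (n mod k)"
        using subadditive_mult_le[OF sub, of "n div k" k "n mod k"] by simp
      also have "\<dots> \<le> real (n div k) * u k + M"
        using k by (intro add_left_mono M) simp
      also have "real (n div k) * u k \<le> (real n / real k) * u k"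
        using nonneg of_nat_div_le_of_nat by (intro mult_right_mono) auto
      finally have "u n / real n \<le> (real n / real k * u k + M) / real n"
        using npos by (simp add: divide_right_mono)
      also have "\<dots> = u k / real k + M / real n"
        using npos k by (simp add: field_simps)
      also have "M / real n < e / 2"
      proof -
        have "2 * M / e < real n" using n0 n by simp
        then show ?thesis using e npos by (simp add: field_simps)
      qed
      finally have "u n / real n < L + e" using k(2) by simp
      moreover have "L \<le> u n / real n" using n by (intro lower) simp
      ultimately show "norm (u n / real n - L) < e" by simp
    qed
  qed
  then show ?thesis by (auto simp: convergent_def)
qed

lemma root_submultiplicative_convergent:
  fixes a :: "nat \<Rightarrow> real"
  assumes sub: "\<And>m n. a (m + n) \<le> a m * a n" and ge1: "\<And>n. 1 \<le> a n"
  shows "convergent (\<lambda>n. root n (a n))"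
proof -
  have pos: "0 < a n" for n using ge1[of n] by linarith
  have "convergent (\<lambda>n. ln (a n) / real n)"
  proof (rule fekete_convergent)
    show "ln (a (m + n)) \<le> ln (a m) + ln (a n)" for m n
      using sub[of m n] pos by (metis ln_mult_pos ln_mono mult_pos_pos)
    show "0 \<le> ln (a n)" for n using ge1 by simp
  qed
  then obtain L where "(\<lambda>n. ln (a n) / real n) \<longlonglongrightarrow> L"
    by (auto simp: convergent_def)
  then have "(\<lambda>n. exp (ln (a n) / real n)) \<longlonglongrightarrow> exp L"
    by (rule tendsto_exp)
  moreover have "\<forall>\<^sub>F n in sequentially. exp (ln (a n) / real n) = root n (a n)"
    using eventually_gt_at_top[of 0]
  proof eventually_elim
    case (elim n)
    then show ?case
      using pos[of n] by (simp add: root_powr_inverse powr_def)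
  qed
  ultimately have "(\<lambda>n. root n (a n)) \<longlonglongrightarrow> exp L"
    by (rule Lim_transform_eventually)
  then show ?thesis by (auto simp: convergent_def)
qed

section \<open>Operators on sequence spaces\<close>

text \<open>Membership in the space is part of the predicate: outside it \<^const>\<open>lp_norm\<close> is a
  default value, and a norm estimate alone would not allow operators to be composed.\<close>

definition lp_bounded_by ::
  "ennreal \<Rightarrow> real \<Rightarrow> ((nat \<Rightarrow> 'a::{real_normed_field,banach}) \<Rightarrow> (nat \<Rightarrow> 'a)) \<Rightarrow> bool" where
  "lp_bounded_by p C A \<longleftrightarrow>
     (\<forall>x\<in>lp_space p. A x \<in> lp_space p \<and> lp_norm p (A x) \<le> C * lp_norm p x)"

lemma lp_norm_nonneg:
  assumes "x \<in> lp_space p"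
  shows "0 \<le> lp_norm p x"
proof (cases "p = \<infinity>")
  case True
  with assms have "norm (x 1) \<le> lp_norm p x"
    unfolding lp_norm_def by (auto simp: lp_space_def intro!: cSUP_upper)
  then show ?thesis
    using norm_ge_zero[of "x 1"] by linarith
qed (simp add: lp_norm_def)

lemma zero_in_lp_space: "(\<lambda>n. 0) \<in> lp_space p"
  by (auto simp: lp_space_def intro!: bdd_aboveI2[where M = 0])

lemma enn2real_ge_1:
  assumes "1 \<le> p" "p \<noteq> \<infinity>"
  shows "1 \<le> enn2real p"
  using enn2real_mono[OF assms(1)] assms(2) by (simp add: top.not_eq_extremum)

lemma enn2real_inverse_eq:
  assumes "1 \<le> p" "p \<noteq> \<infinity>"
  shows "enn2real (1 / p) = 1 / enn2real p"
proof -
  have "p = ennreal (enn2real p)"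
    using assms by (simp add: top.not_eq_extremum)
  then have "1 / p = ennreal (1 / enn2real p)"
    using enn2real_ge_1[OF assms] divide_ennreal[of 1 "enn2real p"] by simp
  then show ?thesis by simp
qed

lemma unit_vector_lp:
  fixes k :: nat
  assumes p: "1 \<le> p" and k: "1 \<le> k"
  defines "e \<equiv> (\<lambda>n. if n = k then 1 else 0 :: 'a::{real_normed_field,banach})"
  shows "e \<in> lp_space p" "lp_norm p e = 1"
proof -
  have "e \<in> lp_space p \<and> lp_norm p e = 1"
  proof (cases "p = \<infinity>")
    case True
    have bdd: "bdd_above ((\<lambda>n. norm (e n)) ` {1..})"
      by (intro bdd_aboveI2[where M = 1]) (simp add: e_def)
    have "(SUP n\<in>{1..}. norm (e n)) = 1"
    proof (rule antisym)
      show "(SUP n\<in>{1..}. norm (e n)) \<le> 1" by (intro cSUP_least) (auto simp: e_def)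
      have "norm (e k) \<le> (SUP n\<in>{1..}. norm (e n))"
        using k bdd by (intro cSUP_upper) auto
      then show "1 \<le> (SUP n\<in>{1..}. norm (e n))" by (simp add: e_def)
    qed
    with True bdd k show ?thesis by (auto simp: lp_space_def lp_norm_def e_def)
  next
    case False
    have "((\<lambda>n. norm (e n) powr enn2real p) has_sum 1) {1..}"
    proof (rule has_sum_finite_neutralI)
      show "finite {k}" "{k} \<subseteq> {1..}" using k by auto
      show "norm (e n) powr enn2real p = 0" if "n \<in> {1..} - {k}" for n
        using that by (simp add: e_def)
      show "1 = (\<Sum>n\<in>{k}. norm (e n) powr enn2real p)" by (simp add: e_def)
    qed
    then show ?thesis
      using False k by (auto simp: lp_space_def lp_norm_def e_def has_sum_imp_summable dest: infsumI)
  qed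
  then show "e \<in> lp_space p" "lp_norm p e = 1" by auto
qed

context
  fixes p :: ennreal and A :: "(nat \<Rightarrow> 'a::{real_normed_field,banach}) \<Rightarrow> (nat \<Rightarrow> 'a)" and C :: real
  assumes A: "lp_bounded_by p C A" and C: "0 \<le> C"
begin

lemma lp_ratio_le: "x \<in> lp_space p \<Longrightarrow> lp_norm p (A x) / lp_norm p x \<le> C"
  using A C lp_norm_nonneg[of x p]
  by (cases "lp_norm p x = 0") (auto simp: lp_bounded_by_def divide_le_eq)

lemma lp_onorm_le: "lp_onorm p A \<le> C"
  unfolding lp_onorm_def using zero_in_lp_space lp_ratio_le by (intro cSUP_least) auto

lemma lp_ratio_le_onorm:
  "x \<in> lp_space p \<Longrightarrow> lp_norm p (A x) / lp_norm p x \<le> lp_onorm p A"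
  unfolding lp_onorm_def using lp_ratio_le by (intro cSUP_upper bdd_aboveI2) auto

lemma lp_onorm_nonneg: "0 \<le> lp_onorm p A"
proof -
  have "0 \<le> lp_norm p (A (\<lambda>n. 0)) / lp_norm p (\<lambda>n. 0 :: 'a)"
    using A zero_in_lp_space by (intro divide_nonneg_nonneg lp_norm_nonneg) (auto simp: lp_bounded_by_def)
  also have "\<dots> \<le> lp_onorm p A" by (intro lp_ratio_le_onorm zero_in_lp_space)
  finally show ?thesis .
qed

text \<open>On a vector of nonzero norm this is the definition of the operator norm; on a vector of norm
  \<open>0\<close> the quotient there is \<open>0 / 0 = 0\<close>, and the given bound \<open>C\<close> is what forces \<open>A x\<close> to
  have norm \<open>0\<close>.\<close>

lemma lp_bounded_by_onorm: "lp_bounded_by p (lp_onorm p A) A"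
  unfolding lp_bounded_by_def
proof
  fix x :: "nat \<Rightarrow> 'a" assume x: "x \<in> lp_space p"
  have Ax: "A x \<in> lp_space p" "lp_norm p (A x) \<le> C * lp_norm p x"
    using A x by (auto simp: lp_bounded_by_def)
  have "lp_norm p (A x) \<le> lp_onorm p A * lp_norm p x"
  proof (cases "lp_norm p x = 0")
    case False
    then have "0 < lp_norm p x" using lp_norm_nonneg[OF x] by simp
    with lp_ratio_le_onorm[OF x] show ?thesis by (simp add: divide_le_eq)
  qed (use Ax in auto)
  with Ax show "A x \<in> lp_space p \<and> lp_norm p (A x) \<le> lp_onorm p A * lp_norm p x" by simp
qed

end

lemma lp_bounded_by_comp:
  fixes A B :: "(nat \<Rightarrow> 'a::{real_normed_field,banach}) \<Rightarrow> (nat \<Rightarrow> 'a)"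
  assumes A: "lp_bounded_by p C A" "0 \<le> C" and B: "lp_bounded_by p D B"
  shows "lp_bounded_by p (C * D) (A \<circ> B)"
  unfolding lp_bounded_by_def
proof (intro ballI conjI)
  fix x :: "nat \<Rightarrow> 'a" assume "x \<in> lp_space p"
  with B have Bx: "B x \<in> lp_space p" "lp_norm p (B x) \<le> D * lp_norm p x"
    by (auto simp: lp_bounded_by_def)
  with A show "(A \<circ> B) x \<in> lp_space p" by (auto simp: lp_bounded_by_def)
  have "lp_norm p ((A \<circ> B) x) \<le> C * lp_norm p (B x)"
    using A Bx by (auto simp: lp_bounded_by_def)
  also have "\<dots> \<le> C * (D * lp_norm p x)"
    using Bx A by (intro mult_left_mono) auto
  finally show "lp_norm p ((A \<circ> B) x) \<le> C * D * lp_norm p x" by simp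
qed

lemma lp_onorm_comp_le:
  assumes A: "lp_bounded_by p C A" "0 \<le> C" and B: "lp_bounded_by p D B" "0 \<le> D"
  shows "lp_onorm p (A \<circ> B) \<le> lp_onorm p A * lp_onorm p B"
  using A B
  by (intro lp_onorm_le lp_bounded_by_comp lp_bounded_by_onorm mult_nonneg_nonneg lp_onorm_nonneg)

section \<open>Summation over the fibres of a map\<close>

definition fibre :: "(nat \<Rightarrow> nat) \<Rightarrow> nat \<Rightarrow> nat set" where
  "fibre f m = {n. 1 \<le> n \<and> f n = m}"

definition fibre_sum :: "(nat \<Rightarrow> nat) \<Rightarrow> (nat \<Rightarrow> 'a::{real_normed_field,banach}) \<Rightarrow> (nat \<Rightarrow> 'a)" where
  "fibre_sum f x = (\<lambda>m. sum x (fibre f m))"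

text \<open>The power mean inequality.  It is Jensen's inequality for \<open>t \<mapsto> t\<^sup>q\<close> with equal weights
  on the open half-line of positive reals; vanishing terms are therefore removed first, which can
  only decrease the number of summands.\<close>

lemma sum_powr_le:
  fixes a :: "'b \<Rightarrow> real"
  assumes S: "finite S" and a: "\<And>i. i \<in> S \<Longrightarrow> 0 \<le> a i" and q: "1 \<le> q"
    and N: "real (card S) \<le> N"
  shows "(\<Sum>i\<in>S. a i) powr q \<le> N powr (q - 1) * (\<Sum>i\<in>S. a i powr q)"
proof -
  define P where "P = {i \<in> S. 0 < a i}"
  have P: "finite P" "P \<subseteq> S" using S by (auto simp: P_def)
  have eqs: "(\<Sum>i\<in>S. a i) = (\<Sum>i\<in>P. a i)" "(\<Sum>i\<in>S. a i powr q) = (\<Sum>i\<in>P. a i powr q)"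
    using S a by (auto intro!: sum.mono_neutral_right simp: P_def order.antisym_conv2)
      (metis a less_eq_real_def)+
  show ?thesis
  proof (cases "P = {}")
    case True
    then show ?thesis by (simp add: eqs)
  next
    case False
    define c where "c = real (card P)"
    have c: "0 < c" using False P by (simp add: c_def card_gt_0_iff)
    have cN: "c \<le> N" using N card_mono[OF S P(2)] by (simp add: c_def)
    have pos: "0 \<le> (\<Sum>i\<in>P. a i)" by (intro sum_nonneg) (auto simp: P_def)
    have "(\<Sum>i\<in>P. (1 / c) *\<^sub>R a i) powr q \<le> (\<Sum>i\<in>P. (1 / c) * a i powr q)"
      using P False c by (intro convex_on_sum[OF _ _ powr_convex[OF q]]) (auto simp: P_def c_def)
    then have "((\<Sum>i\<in>P. a i) / c) powr q \<le> (\<Sum>i\<in>P. a i powr q) / c"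
      by (simp add: sum_divide_distrib)
    then have "(\<Sum>i\<in>P. a i) powr q \<le> c powr q / c * (\<Sum>i\<in>P. a i powr q)"
      using c pos by (simp add: powr_divide field_simps)
    also have "c powr q / c = c powr (q - 1)" using c by (simp add: powr_diff)
    also have "c powr (q - 1) * (\<Sum>i\<in>P. a i powr q) \<le> N powr (q - 1) * (\<Sum>i\<in>P. a i powr q)"
      using c cN q by (intro mult_right_mono powr_mono2 sum_nonneg) auto
    finally show ?thesis by (simp add: eqs)
  qed
qed

text \<open>For finite \<open>p\<close> the power mean inequality is applied on each fibre; the fibres partition
  the index set, so summing the estimates over all fibres restores the whole \<open>p\<close>-th power sum
  of \<open>x\<close>.  For \<open>p = \<infinity>\<close> a fibre sum has at most \<open>N\<close> terms, in accordance with \<open>1 / \<infinity> = 0\<close>.\<close>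

lemma fibre_sum_bounded:
  assumes p: "1 \<le> p" and f: "\<And>n. 1 \<le> n \<Longrightarrow> 1 \<le> f n"
    and fin: "\<And>m. finite (fibre f m)" and N: "\<And>m. real (card (fibre f m)) \<le> N"
  shows "lp_bounded_by p (N powr (1 - enn2real (1 / p)))
           (fibre_sum f :: (nat \<Rightarrow> 'a::{real_normed_field,banach}) \<Rightarrow> (nat \<Rightarrow> 'a))"
  unfolding lp_bounded_by_def
proof
  fix x :: "nat \<Rightarrow> 'a" assume x: "x \<in> lp_space p"
  have "fibre f 0 = {}" using f by (fastforce simp: fibre_def)
  then have at0: "fibre_sum f x 0 = 0" by (simp add: fibre_sum_def)
  have N0: "0 \<le> N" using N[of 0] of_nat_0_le_iff order_trans by blast
  show "fibre_sum f x \<in> lp_space p \<and>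
        lp_norm p (fibre_sum f x) \<le> N powr (1 - enn2real (1 / p)) * lp_norm p x"
  proof (cases "p = \<infinity>")
    case True
    have bdd: "bdd_above ((\<lambda>n. norm (x n)) ` {1..})"
      using x True by (simp add: lp_space_def)
    have M: "norm (x n) \<le> lp_norm p x" if "1 \<le> n" for n
      unfolding lp_norm_def using that bdd True by (auto intro!: cSUP_upper)
    have le: "norm (fibre_sum f x m) \<le> N * lp_norm p x" for m
    proof -
      have "norm (fibre_sum f x m) \<le> real (card (fibre f m)) * lp_norm p x"
        unfolding fibre_sum_def using M by (intro sum_norm_bound) (auto simp: fibre_def)
      also have "\<dots> \<le> N * lp_norm p x"
        using N lp_norm_nonneg[OF x] by (intro mult_right_mono)
      finally show ?thesis .
    qed
    have "fibre_sum f x \<in> lp_space p"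
      using True le at0 by (auto simp: lp_space_def intro!: bdd_aboveI2)
    moreover have "lp_norm p (fibre_sum f x) \<le> N * lp_norm p x"
      using True le by (subst lp_norm_def) (auto intro!: cSUP_least)
    ultimately show ?thesis using True N0 by simp
  next
    case False
    define q where "q = enn2real p"
    have q: "1 \<le> q" using enn2real_ge_1[OF p False] by (simp add: q_def)
    define g where "g n = norm (x n) powr q" for n
    have g: "g summable_on {1..}"
      using x False by (simp add: lp_space_def g_def[abs_def] q_def)
    have bij: "bij_betw snd (SIGMA m:{1..}. fibre f m) {1..}"
    proof (rule bij_betw_byWitness[where f' = "\<lambda>n. (f n, n)"])
      show "(\<lambda>n. (f n, n)) ` {1..} \<subseteq> (SIGMA m:{1..}. fibre f m)"
      proof (rule image_subsetI)
        fix n :: nat assume "n \<in> {1..}"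
        then show "(f n, n) \<in> (SIGMA m:{1..}. fibre f m)"
          using f[of n] by (simp add: fibre_def)
      qed
    qed (auto simp: fibre_def)
    have gS: "(\<lambda>(m, n). g n) summable_on (SIGMA m:{1..}. fibre f m)"
      using summable_on_reindex_bij_betw[OF bij, of g] g by (simp add: case_prod_beta')
    have sum1: "(\<lambda>m. sum g (fibre f m)) summable_on {1..}"
      using summable_on_Sigma_banach[OF gS] fin by simp
    have sum2: "(\<Sum>\<^sub>\<infinity>m\<in>{1..}. sum g (fibre f m)) = infsum g {1..}"
      using infsum_Sigma'_banach[OF gS] fin infsum_reindex_bij_betw[OF bij, of g]
      by (simp add: case_prod_beta')
    have le: "norm (fibre_sum f x m) powr q \<le> N powr (q - 1) * sum g (fibre f m)" for m
    proof -
      have "norm (fibre_sum f x m) powr q \<le> (\<Sum>n\<in>fibre f m. norm (x n)) powr q"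
        unfolding fibre_sum_def using q by (intro powr_mono2 norm_sum) auto
      also have "\<dots> \<le> N powr (q - 1) * sum g (fibre f m)"
        unfolding g_def using fin q N by (intro sum_powr_le) auto
      finally show ?thesis .
    qed
    have sumL: "(\<lambda>m. norm (fibre_sum f x m) powr q) summable_on {1..}"
      by (rule summable_on_comparison_test
          [OF summable_on_cmult_right[OF sum1, of "N powr (q - 1)"]]) (use le in auto)
    have "(\<Sum>\<^sub>\<infinity>m\<in>{1..}. norm (fibre_sum f x m) powr q)
        \<le> (\<Sum>\<^sub>\<infinity>m\<in>{1..}. N powr (q - 1) * sum g (fibre f m))"
      using le by (intro infsum_mono sumL summable_on_cmult_right[OF sum1]) auto
    also have "\<dots> = N powr (q - 1) * infsum g {1..}"
      by (simp only: infsum_cmult_right' sum2)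
    finally have "(\<Sum>\<^sub>\<infinity>m\<in>{1..}. norm (fibre_sum f x m) powr q) powr (1 / q)
        \<le> (N powr (q - 1) * infsum g {1..}) powr (1 / q)"
      using q by (intro powr_mono2 infsum_nonneg) auto
    also have "\<dots> = N powr ((q - 1) / q) * infsum g {1..} powr (1 / q)"
      by (simp add: powr_mult infsum_nonneg powr_powr g_def)
    also have "(q - 1) / q = 1 - enn2real (1 / p)"
      using q enn2real_inverse_eq[OF p False] by (simp add: q_def field_simps)
    finally show ?thesis
      using False sumL at0 by (simp add: lp_space_def lp_norm_def q_def g_def[abs_def])
  qed
qed

lemma fibre_comp:
  assumes "\<And>n. 1 \<le> n \<Longrightarrow> 1 \<le> g n"
  shows "fibre (f \<circ> g) m = (\<Union>k\<in>fibre f m. fibre g k)"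
  using assms by (auto simp: fibre_def)

lemma fibre_sum_comp:
  assumes "\<And>n. 1 \<le> n \<Longrightarrow> 1 \<le> g n" "\<And>m. finite (fibre f m)" "\<And>m. finite (fibre g m)"
  shows "fibre_sum f (fibre_sum g x) = fibre_sum (f \<circ> g) x"
proof
  fix m
  have "sum x (\<Union>k\<in>fibre f m. fibre g k) = (\<Sum>k\<in>fibre f m. sum x (fibre g k))"
    by (intro sum.UNION_disjoint assms(2) ballI assms(3)) (auto simp: fibre_def)
  then show "fibre_sum f (fibre_sum g x) m = fibre_sum (f \<circ> g) x m"
    by (simp only: fibre_sum_def fibre_comp[of g f, OF assms(1)])
qed

section \<open>Counting Collatz predecessors\<close>

lemma collatz_funpow_ge_1: "1 \<le> n \<Longrightarrow> 1 \<le> (collatz ^^ j) n"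
  by (induction j) (auto intro: collatz_ge_1[simplified])

lemma fibre_collatz_subset: "fibre collatz m \<subseteq> {2 * m, (2 * m - 1) div 3}"
  by (auto simp: fibre_def collatz_def split: if_splits elim!: evenE oddE)

text \<open>An odd number \<open>2 * k + 1\<close> is mapped to \<open>3 * k + 2\<close>.\<close>

lemma fibre_collatz_subset_not_2:
  assumes "m mod 3 \<noteq> 2"
  shows "fibre collatz m \<subseteq> {2 * m}"
proof
  fix n assume n: "n \<in> fibre collatz m"
  have "even n"
  proof (rule ccontr)
    assume "odd n"
    then obtain k where "n = 2 * k + 1" by (elim oddE)
    with n have "m = 3 * k + 2" by (simp add: fibre_def collatz_def)
    with assms show False by presburger
  qed
  with n show "n \<in> {2 * m}" by (auto simp: fibre_def collatz_def)
qed

lemma fibre_collatz_Suc: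
  "fibre (collatz ^^ Suc j) m = (\<Union>k\<in>fibre collatz m. fibre (collatz ^^ j) k)"
  unfolding funpow.simps by (intro fibre_comp collatz_funpow_ge_1)

lemma finite_fibre_collatz: "finite (fibre (collatz ^^ j) m)"
proof (induction j arbitrary: m)
  case 0
  show ?case by (rule finite_subset[of _ "{m}"]) (auto simp: fibre_def)
next
  case (Suc j)
  have "finite (fibre collatz m)" using fibre_collatz_subset by (rule finite_subset) simp
  with Suc show ?case unfolding fibre_collatz_Suc by blast
qed

text \<open>The induction follows the recursion of the Fibonacci numbers, with \<open>\<phi>\<^sup>2 = \<phi> + 1\<close>.
  The exponent \<open>j + 1\<close> is what the start requires: one step can have two predecessors,
  and \<open>\<phi> < 2 < \<phi>\<^sup>2\<close>.\<close>

lemma card_fibre_collatz_le: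
  defines "\<phi> \<equiv> (1 + sqrt 5) / 2"
  shows "real (card (fibre (collatz ^^ j) m)) \<le> \<phi> ^ (j + 1)"
proof (induction j arbitrary: m rule: induct_nat_012)
  have phi: "1 \<le> \<phi>" "\<phi> ^ 2 = \<phi> + 1"
    by (auto simp: \<phi>_def power2_eq_square field_simps)
  {
    case 0
    have "card (fibre (collatz ^^ 0) m) \<le> card {m}"
      by (intro card_mono) (auto simp: fibre_def)
    also have "card {m} = 1" by simp
    finally have "real (card (fibre (collatz ^^ 0) m)) \<le> \<phi>" using phi(1) by linarith
    then show ?case by (simp only: add_0 power_one_right)
  next
    case 1
    have "card (fibre (collatz ^^ Suc 0) m) \<le> 2"
      using collatz_fibre(2)[of m] by (simp add: fibre_def)
    then have "real (card (fibre (collatz ^^ Suc 0) m)) \<le> \<phi> ^ 2"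
      unfolding phi(2) using phi(1) by linarith
    then show ?case by (simp only: One_nat_def[symmetric] one_add_one)
  next
    case (ge2 j)
    show ?case
    proof (cases "m mod 3 = 2")
      case True
      \<comment> \<open>Two branches start here, but the one through \<open>2 * m\<close> has only \<open>4 * m\<close> above it.\<close>
      then have "2 * m mod 3 \<noteq> 2" by presburger
      then have "fibre (collatz ^^ Suc j) (2 * m) \<subseteq> fibre (collatz ^^ j) (2 * (2 * m))"
        using fibre_collatz_subset_not_2[of "2 * m"] unfolding fibre_collatz_Suc by blast
      then have "fibre (collatz ^^ Suc (Suc j)) m \<subseteq>
          fibre (collatz ^^ j) (2 * (2 * m)) \<union> fibre (collatz ^^ Suc j) ((2 * m - 1) div 3)"
        using fibre_collatz_subset[of m] unfolding fibre_collatz_Suc[of "Suc j"] by blast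
      then have "card (fibre (collatz ^^ Suc (Suc j)) m) \<le>
          card (fibre (collatz ^^ j) (2 * (2 * m))) + card (fibre (collatz ^^ Suc j) ((2 * m - 1) div 3))"
        by (meson card_Un_le card_mono finite_UnI finite_fibre_collatz order_trans)
      then have "real (card (fibre (collatz ^^ Suc (Suc j)) m)) \<le> \<phi> ^ (j + 1) + \<phi> ^ (Suc j + 1)"
        using ge2(1)[of "2 * (2 * m)"] ge2(2)[of "(2 * m - 1) div 3"] by linarith
      also have "\<dots> = \<phi> ^ (j + 1) * \<phi> ^ 2" by (simp add: phi algebra_simps)
      also have "\<dots> = \<phi> ^ (Suc (Suc j) + 1)" by (simp flip: power_add)
      finally show ?thesis .
    next
      case False
      then have "fibre (collatz ^^ Suc (Suc j)) m \<subseteq> fibre (collatz ^^ Suc j) (2 * m)"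
        using fibre_collatz_subset_not_2[of m] unfolding fibre_collatz_Suc[of "Suc j"] by blast
      then have "card (fibre (collatz ^^ Suc (Suc j)) m) \<le> card (fibre (collatz ^^ Suc j) (2 * m))"
        by (intro card_mono finite_fibre_collatz)
      then have "real (card (fibre (collatz ^^ Suc (Suc j)) m)) \<le> \<phi> ^ (Suc j + 1)"
        using ge2(2)[of "2 * m"] by linarith
      also have "\<dots> \<le> \<phi> ^ (Suc (Suc j) + 1)"
        using phi by (intro power_increasing) auto
      finally show ?thesis .
    qed
  }
qed

section \<open>The spectral radius\<close>

lemma forward_koopman_eq_fibre_sum: "forward_koopman = fibre_sum collatz"
  by (simp add: fun_eq_iff forward_koopman_def fibre_sum_def fibre_def)

text \<open>The operator ignores the coordinate at \<open>0\<close> and returns \<open>0\<close> there, whereas its power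
  with exponent \<open>0\<close> is the identity; this is why \<open>x 0 = 0\<close> is assumed.\<close>

lemma forward_koopman_funpow:
  assumes "x 0 = 0"
  shows "(forward_koopman ^^ j) x = fibre_sum (collatz ^^ j) x"
proof (induction j)
  case 0
  have "fibre (\<lambda>n. n) m = (if m = 0 then {} else {m})" for m
    by (auto simp: fibre_def)
  with assms show ?case by (simp add: fibre_sum_def fun_eq_iff id_def)
next
  case (Suc j)
  have "(forward_koopman ^^ Suc j) x = fibre_sum collatz (fibre_sum (collatz ^^ j) x)"
    using Suc by (simp add: forward_koopman_eq_fibre_sum)
  also have "\<dots> = fibre_sum (collatz \<circ> collatz ^^ j) x"
    using finite_fibre_collatz[of 1]
    by (intro fibre_sum_comp collatz_funpow_ge_1 finite_fibre_collatz) auto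
  finally show ?case by (simp only: funpow.simps)
qed

lemma forward_koopman_funpow_bounded:
  assumes "1 \<le> p"
  shows "lp_bounded_by p ((((1 + sqrt 5) / 2) ^ (j + 1)) powr (1 - enn2real (1 / p)))
           (forward_koopman ^^ j :: (nat \<Rightarrow> 'a::{real_normed_field,banach}) \<Rightarrow> (nat \<Rightarrow> 'a))"
proof -
  have "(forward_koopman ^^ j) x = fibre_sum (collatz ^^ j) x" if "x \<in> lp_space p" for x :: "nat \<Rightarrow> 'a"
    using that by (intro forward_koopman_funpow) (simp add: lp_space_def)
  moreover have "lp_bounded_by p ((((1 + sqrt 5) / 2) ^ (j + 1)) powr (1 - enn2real (1 / p)))
      (fibre_sum (collatz ^^ j) :: (nat \<Rightarrow> 'a) \<Rightarrow> (nat \<Rightarrow> 'a))"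
    by (intro fibre_sum_bounded assms collatz_funpow_ge_1 finite_fibre_collatz card_fibre_collatz_le)
  ultimately show ?thesis by (simp add: lp_bounded_by_def cong: ball_cong)
qed

lemma forward_koopman_funpow_unit_vector:
  assumes "1 \<le> n"
  shows "(forward_koopman ^^ j) (\<lambda>k. if k = n then 1 else 0)
       = (\<lambda>k. if k = (collatz ^^ j) n then 1 else 0)"
  by (induction j) (simp_all add: forward_koopman_unit_vector collatz_funpow_ge_1[OF assms, simplified])

lemma lp_onorm_forward_koopman_funpow_ge_1:
  assumes p: "1 \<le> p"
  shows "1 \<le> lp_onorm p (forward_koopman ^^ j ::
           (nat \<Rightarrow> 'a::{real_normed_field,banach}) \<Rightarrow> (nat \<Rightarrow> 'a))"
proof -
  have "(1::nat) \<le> 1" by simp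
  note e = unit_vector_lp[OF p this, where 'a = 'a]
    unit_vector_lp(2)[OF p collatz_funpow_ge_1[OF this, of j], where 'a = 'a]
  show ?thesis
    using lp_ratio_le_onorm[OF forward_koopman_funpow_bounded[OF p, of j] _ e(1)] e(2,3)
    by (simp add: forward_koopman_funpow_unit_vector)
qed

lemma root_lp_onorm_forward_koopman_tendsto:
  fixes p :: ennreal
  assumes p: "1 \<le> p"
  defines "L \<equiv> (forward_koopman :: (nat \<Rightarrow> 'a::{real_normed_field,banach}) \<Rightarrow> (nat \<Rightarrow> 'a))"
  shows "(\<lambda>n. root n (lp_onorm p (L ^^ n))) \<longlonglongrightarrow> lp_spectral_radius p L"
proof -
  note bdd = forward_koopman_funpow_bounded[OF p]
  have "convergent (\<lambda>n. root n (lp_onorm p (L ^^ n)))"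
  proof (rule root_submultiplicative_convergent)
    show "lp_onorm p (L ^^ (m + n)) \<le> lp_onorm p (L ^^ m) * lp_onorm p (L ^^ n)" for m n
      unfolding L_def funpow_add by (rule lp_onorm_comp_le[OF bdd _ bdd]) auto
    show "1 \<le> lp_onorm p (L ^^ n)" for n
      unfolding L_def by (rule lp_onorm_forward_koopman_funpow_ge_1[OF p])
  qed
  then show ?thesis
    unfolding lp_spectral_radius_def by (simp add: convergent_LIMSEQ_iff)
qed

lemma lp_spectral_radius_forward_koopman_ge_1:
  assumes p: "1 \<le> p"
  shows "1 \<le> lp_spectral_radius p
           (forward_koopman :: (nat \<Rightarrow> 'a::{real_normed_field,banach}) \<Rightarrow> (nat \<Rightarrow> 'a))"
proof (rule tendsto_lowerbound[OF root_lp_onorm_forward_koopman_tendsto[OF p]])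
  show "\<forall>\<^sub>F n in sequentially. 1 \<le> root n (lp_onorm p
      (forward_koopman ^^ n :: (nat \<Rightarrow> 'a) \<Rightarrow> (nat \<Rightarrow> 'a)))"
    using eventually_gt_at_top[of 0]
    by eventually_elim (simp add: lp_onorm_forward_koopman_funpow_ge_1[OF p])
qed simp

lemma lp_spectral_radius_forward_koopman_le:
  assumes p: "1 \<le> p"
  shows "lp_spectral_radius p
           (forward_koopman :: (nat \<Rightarrow> 'a::{real_normed_field,banach}) \<Rightarrow> (nat \<Rightarrow> 'a))
         \<le> ((1 + sqrt 5) / 2) powr (1 - enn2real (1 / p))"
proof -
  define D where "D = ((1 + sqrt 5) / 2) powr (1 - enn2real (1 / p))"
  have D: "0 < D" by (simp add: D_def add_pos_pos less_imp_neq[symmetric])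
  have onorm_le: "lp_onorm p (forward_koopman ^^ n :: (nat \<Rightarrow> 'a) \<Rightarrow> (nat \<Rightarrow> 'a)) \<le> D ^ (n + 1)" for n
  proof -
    have "lp_onorm p (forward_koopman ^^ n :: (nat \<Rightarrow> 'a) \<Rightarrow> (nat \<Rightarrow> 'a))
        \<le> (((1 + sqrt 5) / 2) ^ (n + 1)) powr (1 - enn2real (1 / p))"
      by (rule lp_onorm_le[OF forward_koopman_funpow_bounded[OF p]]) simp
    also have "(((1 + sqrt 5) / 2) ^ j) powr (1 - enn2real (1 / p)) = D ^ j" for j
      unfolding D_def by (induction j) (simp_all add: powr_mult del: times_divide_eq_left)
    finally show ?thesis .
  qed
  have "\<forall>\<^sub>F n in sequentially. root n (lp_onorm p
      (forward_koopman ^^ n :: (nat \<Rightarrow> 'a) \<Rightarrow> (nat \<Rightarrow> 'a))) \<le> D * root n D"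
    using eventually_gt_at_top[of 0]
  proof eventually_elim
    case (elim n)
    have "root n (lp_onorm p (forward_koopman ^^ n :: (nat \<Rightarrow> 'a) \<Rightarrow> (nat \<Rightarrow> 'a))) \<le> root n (D ^ n * D)"
      using onorm_le[of n] elim by (simp add: mult.commute)
    also have "\<dots> = D * root n D"
      using elim D by (simp add: real_root_mult real_root_power_cancel)
    finally show ?case .
  qed
  moreover have "(\<lambda>n. D * root n D) \<longlonglongrightarrow> D * 1"
    using D by (intro tendsto_mult_left LIMSEQ_root_const)
  ultimately show ?thesis
    using root_lp_onorm_forward_koopman_tendsto[OF p, where 'a = 'a]
    unfolding D_def[symmetric] by (auto intro: tendsto_le[OF sequentially_bot])
qed

theorem corollary5p5:
  shows "(\<forall>p::ennreal. 1 \<le> p \<longrightarrow>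
            1 \<le> lp_spectral_radius p
                   (forward_koopman :: (nat \<Rightarrow> 'a::{real_normed_field,banach}) \<Rightarrow> (nat \<Rightarrow> 'a)) \<and>
            lp_spectral_radius p (forward_koopman :: (nat \<Rightarrow> 'a) \<Rightarrow> (nat \<Rightarrow> 'a))
              \<le> ((1 + sqrt 5) / 2) powr (1 - enn2real (1 / p))) \<and>
         lp_spectral_radius 1 (forward_koopman :: (nat \<Rightarrow> 'a) \<Rightarrow> (nat \<Rightarrow> 'a)) = 1"
proof (intro conjI allI impI lp_spectral_radius_forward_koopman_ge_1
    lp_spectral_radius_forward_koopman_le)
  have "lp_spectral_radius 1 (forward_koopman :: (nat \<Rightarrow> 'a) \<Rightarrow> (nat \<Rightarrow> 'a)) \<le> 1"
    using lp_spectral_radius_forward_koopman_le[of 1, where 'a = 'a]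
    by (simp split: if_splits)
  moreover have "1 \<le> lp_spectral_radius 1 (forward_koopman :: (nat \<Rightarrow> 'a) \<Rightarrow> (nat \<Rightarrow> 'a))"
    by (rule lp_spectral_radius_forward_koopman_ge_1) simp
  ultimately show "lp_spectral_radius 1 (forward_koopman :: (nat \<Rightarrow> 'a) \<Rightarrow> (nat \<Rightarrow> 'a)) = 1"
    by (rule antisym)
qed

end
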